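(* Let $n\ge 3$ and let $R$ be a face of a simple drawing $D$ of the complete graph $K_n$ in the sphere $\mathbb S^2$. For each 3-cycle $T$ of $K_n$, let $S^R_T$ denote the side of $T$ in $D$ that contains $R$. Then $$R=\bigcap_{T} S^R_T,$$ where the intersection is over all 3-cycles $T$ in $K_n$.
   Context: Drawing: in a drawing $D$ of $K_n$ in the sphere $\mathbb S^2$, each vertex is represented by a distinct point of $\mathbb S^2$, and each edge is represented by an arc joining the points representing its two incident vertices. No edge contains a vertex-point in its interior, and any two edge-arcs have finitely many intersections, all of which are either common endpoints or crossings. More than two edges are allowed to cross at the same point. Vertices and edges are identified with the points and arcs representing them, and $D[K_n]$ denotes the union of all these points and arcs. Simple drawing: a drawing is simple if any two distinct closed edges have at most one point in common, this point being either a vertex (common endpoint) or a crossing. Face: a face of $D$ is a connected component of $\mathbb S^2\setminus D[K_n]$ (an open set). Sides of a 3-cycle: in a simple drawing, the three edges of a 3-cycle $T$ of $K_n$ pairwise meet only at their common end vertices, so the drawing $D[T]$ of $T$ is a simple closed curve. The sides of $T$ in $D$ are the two connected components of $\mathbb S^2\setminus D[T]$ (open discs). Each face of $D$ is contained in exactly one side of $T$. *)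

theory Defs
  imports "HOL-Analysis.Analysis" "HOL-Library.Ramsey"
begin

abbreviation S2 :: "(real^3) set" where
  "S2 \<equiv> sphere 0 1"

text \<open>
  The vertices of \<open>K\<^sub>n\<close> are the numbers below \<open>n\<close>. An edge is the set of its two end vertices,
  and a 3-cycle, which is determined by its vertices, is the set of its three vertices.
\<close>

abbreviation verts :: "nat \<Rightarrow> nat set" where
  "verts n \<equiv> {..<n}"

abbreviation edges :: "nat \<Rightarrow> nat set set" where
  "edges n \<equiv> nsets (verts n) 2"

abbreviation three_cycles :: "nat \<Rightarrow> nat set set" where
  "three_cycles n \<equiv> nsets (verts n) 3"

text \<open>
  Two arcs \<open>A\<close> and \<open>B\<close> in the sphere cross at \<open>x\<close> if, in some chart of a neighbourhood of \<open>x\<close>, they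
  look like two perpendicular diameters of the open unit disc. In particular \<open>x\<close> is then an
  end point of neither arc, and the arcs do not merely touch at \<open>x\<close>.
\<close>

definition crossing_at :: "(real^3) set \<Rightarrow> (real^3) set \<Rightarrow> real^3 \<Rightarrow> bool" where
  "crossing_at A B x \<longleftrightarrow>
     (\<exists>U h k. openin (top_of_set S2) U \<and> x \<in> U \<and>
        homeomorphism U (ball (0::complex) 1) h k \<and> h x = 0 \<and>
        h ` (A \<inter> U) = {z \<in> ball 0 1. Im z = 0} \<and>
        h ` (B \<inter> U) = {z \<in> ball 0 1. Re z = 0})"

text \<open>
  A drawing of \<open>K\<^sub>n\<close> sends each vertex \<open>i\<close> to a point \<open>v i\<close> and each edge \<open>e\<close> to the point set \<open>E e\<close> of
  an arc; \<open>E e - v ` e\<close> is the interior of that arc.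
\<close>

definition drawing :: "nat \<Rightarrow> (nat \<Rightarrow> real^3) \<Rightarrow> (nat set \<Rightarrow> (real^3) set) \<Rightarrow> bool" where
  "drawing n v E \<longleftrightarrow>
     inj_on v (verts n) \<and> v ` verts n \<subseteq> S2 \<and>
     (\<forall>e\<in>edges n. E e \<subseteq> S2 \<and>
        (\<exists>g. arc g \<and> path_image g = E e \<and> {pathstart g, pathfinish g} = v ` e)) \<and>
     (\<forall>e\<in>edges n. v ` verts n \<inter> (E e - v ` e) = {}) \<and>
     (\<forall>e\<in>edges n. \<forall>f\<in>edges n. e \<noteq> f \<longrightarrow>
        finite (E e \<inter> E f) \<and>
        (\<forall>x\<in>E e \<inter> E f. x \<in> v ` e \<inter> v ` f \<or> crossing_at (E e) (E f) x))"

definition simple_drawing :: "nat \<Rightarrow> (nat \<Rightarrow> real^3) \<Rightarrow> (nat set \<Rightarrow> (real^3) set) \<Rightarrow> bool" where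
  "simple_drawing n v E \<longleftrightarrow> drawing n v E \<and>
     (\<forall>e\<in>edges n. \<forall>f\<in>edges n. e \<noteq> f \<longrightarrow> (\<exists>x. E e \<inter> E f \<subseteq> {x}))"

definition drawn_graph :: "nat \<Rightarrow> (nat \<Rightarrow> real^3) \<Rightarrow> (nat set \<Rightarrow> (real^3) set) \<Rightarrow> (real^3) set" where
  "drawn_graph n v E = v ` verts n \<union> (\<Union>e\<in>edges n. E e)"

definition faces :: "nat \<Rightarrow> (nat \<Rightarrow> real^3) \<Rightarrow> (nat set \<Rightarrow> (real^3) set) \<Rightarrow> (real^3) set set" where
  "faces n v E = components (S2 - drawn_graph n v E)"

text \<open>The vertex points of \<open>T\<close> need not be added below: they are end points of the arcs.\<close>

definition drawn_cycle :: "(nat set \<Rightarrow> (real^3) set) \<Rightarrow> nat set \<Rightarrow> (real^3) set" where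
  "drawn_cycle E T = (\<Union>e\<in>nsets T 2. E e)"

definition sides :: "(nat set \<Rightarrow> (real^3) set) \<Rightarrow> nat set \<Rightarrow> (real^3) set set" where
  "sides E T = components (S2 - drawn_cycle E T)"

definition side_containing ::
    "(nat set \<Rightarrow> (real^3) set) \<Rightarrow> nat set \<Rightarrow> (real^3) set \<Rightarrow> (real^3) set" where
  "side_containing E T R = (THE S. S \<in> sides E T \<and> R \<subseteq> S)"

text \<open>The description in \<^const>\<open>side_containing\<close> is proper for every face.\<close>

lemma side_containing_ex1:
  assumes R: "R \<in> faces n v E" and T: "T \<in> three_cycles n"
  shows "\<exists>!S. S \<in> sides E T \<and> R \<subseteq> S"
proof -
  have "nsets T 2 \<subseteq> edges n"
    using T by (auto simp: nsets_def)
  then have "drawn_cycle E T \<subseteq> drawn_graph n v E"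
    by (auto simp: drawn_cycle_def drawn_graph_def)
  moreover have "R \<subseteq> S2 - drawn_graph n v E" "connected R" and ne: "R \<noteq> {}"
    using R in_components_subset in_components_connected in_components_nonempty
    unfolding faces_def by blast+
  ultimately have sub: "R \<subseteq> S2 - drawn_cycle E T" and con: "connected R"
    by auto
  then obtain S where S: "S \<in> sides E T" "R \<subseteq> S"
    using exists_component_superset[OF sub _ con] ne unfolding sides_def by blast
  moreover have "S' = S" if "S' \<in> sides E T" "R \<subseteq> S'" for S'
    using components_nonoverlap[of S' "S2 - drawn_cycle E T" S] S that ne
    unfolding sides_def by blast
  ultimately show ?thesis by blast
qed

end

theory Submission
  imports Defs
begin

text \<open>
  Each side contains \<open>R\<close>, and a point that lies in a side of every 3-cycle is off the drawing. So
  the theorem says that two points \<open>p\<close> and \<open>q\<close> off the drawing which no 3-cycle separates are in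
  the same face.

  Let the stereographic projection \<open>\<phi>\<close> send \<open>p\<close> to \<open>0\<close> and \<open>q\<close> to infinity. By Borsuk's separation
  criterion, a compact set \<open>K\<close> that avoids both points does not separate them if and only if
  \<open>\<phi>\<close> has a continuous logarithm on \<open>K\<close> (\<open>connected_component_sphere_iff_log_branch\<close>). Such a
  logarithm is a lift of \<open>K\<close> to the universal covering of the sphere without \<open>p\<close> and \<open>q\<close>, which is
  a plane. Each edge has lifts because it is an arc, and each 3-cycle has one by hypothesis. As
  the 3-cycles through a fixed vertex generate all cycles, the lifts of the edges can be chosen so that
  they agree at all vertices (\<open>normalised_edge_logs_ex\<close>).

  It remains to see that the lifts of two edges also agree where the edges cross; they then glue to a
  logarithm on the whole drawing. If they do not agree, then the edges cross with a nonzero shift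
  \<open>k\<close>, a multiple of \<open>2 \<pi> \<i>\<close>: a crossing point of one lifted edge with a translate by \<open>k\<close> of
  another. A lifted 3-cycle and a translate of a lifted 3-cycle are Jordan curves in the plane. They
  cannot cross in exactly one point, and they share neither vertices nor edges, not even if the two
  3-cycles do. Applying this to two pairs of 3-cycles on the four ends of the crossing edges gives
  a contradiction (\<open>crossing_edges_agree\<close>).
\<close>

section \<open>Branches of the logarithm\<close>

definition log_branch :: "('a::real_normed_vector \<Rightarrow> complex) \<Rightarrow> 'a set \<Rightarrow> ('a \<Rightarrow> complex) \<Rightarrow> bool" where
  "log_branch f K g \<longleftrightarrow> continuous_on K g \<and> (\<forall>x\<in>K. f x = exp (g x))"

lemma log_branchD: "log_branch f K g \<Longrightarrow> x \<in> K \<Longrightarrow> f x = exp (g x)"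
  by (simp add: log_branch_def)

lemma log_branch_subset: "log_branch f K g \<Longrightarrow> J \<subseteq> K \<Longrightarrow> log_branch f J g"
  unfolding log_branch_def by (meson continuous_on_subset subset_iff)

lemma log_branch_continuous: "log_branch f K g \<Longrightarrow> continuous_on K f"
  unfolding log_branch_def
  by (metis (no_types, lifting) continuous_on_cong continuous_on_exp)

lemma log_branch_add: "log_branch f K g \<Longrightarrow> exp c = 1 \<Longrightarrow> log_branch f K (\<lambda>x. g x + c)"
  unfolding log_branch_def by (auto intro!: continuous_intros simp: exp_add)

lemma log_branch_compose:
  assumes "log_branch f K g" "continuous_on I k" "k ` I \<subseteq> K"
  shows "log_branch (f \<circ> k) I (g \<circ> k)"
  using assms continuous_on_subset[of K g "k ` I"] unfolding log_branch_def
  by (auto simp del: o_apply intro!: continuous_on_compose) auto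

text \<open>
  A branch is a lift of the function through the covering of the punctured plane by the
  exponential function, so it is determined by its value at one point of a connected set.
\<close>

lemma log_branch_unique:
  assumes "log_branch f K g" "log_branch f K h" "connected K" "a \<in> K" "g a = h a" "x \<in> K"
  shows "g x = h x"
proof (rule covering_space_lift_unique[OF covering_space_exp_punctured_plane,
      where a = a and f = f and T = K])
  show "continuous_on K f" by (rule log_branch_continuous[OF assms(1)])
  show "f \<in> K \<rightarrow> - {0}" using assms(1) by (simp add: log_branch_def)
  show "continuous_on K g" "continuous_on K h" "y \<in> K \<Longrightarrow> f y = exp (g y)"
    "y \<in> K \<Longrightarrow> f y = exp (h y)" for y
    using assms(1,2) by (simp_all add: log_branch_def)
qed (use assms in auto)

lemma log_branch_contractible_ex:
  assumes "continuous_on K f" "contractible K" "\<And>x. x \<in> K \<Longrightarrow> f x \<noteq> 0" "a \<in> K" "f a = exp w"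
  obtains g where "log_branch f K g" "g a = w"
proof -
  obtain g where g: "log_branch f K g"
    using continuous_logarithm_on_contractible[OF assms(1-3)] unfolding log_branch_def by metis
  then have "exp (w - g a) = 1"
    using assms(4,5) by (auto simp: log_branch_def exp_diff)
  from log_branch_add[OF g this] show ?thesis
    by (intro that[of "\<lambda>x. g x + (w - g a)"]) auto
qed

lemma log_branch_paste:
  assumes "finite I" "\<And>i. i \<in> I \<Longrightarrow> closed (U i)" "\<And>i. i \<in> I \<Longrightarrow> log_branch f (U i) (g i)"
    and agree: "\<And>i j x. i \<in> I \<Longrightarrow> j \<in> I \<Longrightarrow> x \<in> U i \<Longrightarrow> x \<in> U j \<Longrightarrow> g i x = g j x"
  shows "\<exists>h. log_branch f (\<Union>i\<in>I. U i) h \<and> (\<forall>i\<in>I. \<forall>x\<in>U i. h x = g i x)"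
proof -
  define h where "h x = g (SOME i. i \<in> I \<and> x \<in> U i) x" for x
  have h: "h x = g i x" if "i \<in> I" "x \<in> U i" for i x
    unfolding h_def using someI[of "\<lambda>i. i \<in> I \<and> x \<in> U i" i] that agree by blast
  have "continuous_on (U i) h" if "i \<in> I" for i
    using assms(3)[OF that] h[OF that] unfolding log_branch_def
    by (metis (no_types, lifting) continuous_on_cong)
  then have "continuous_on (\<Union>i\<in>I. U i) h"
    using assms(1,2) by (intro continuous_on_closed_Union) auto
  then have "log_branch f (\<Union>i\<in>I. U i) h"
    using assms(3) h unfolding log_branch_def by auto
  with h show ?thesis by blast
qed

section \<open>Separation of two points of the sphere\<close>

text \<open>
  Borsuk's criterion says that \<open>0\<close> lies in a bounded component of the complement of \<open>K\<close> exactly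
  if the radial projection of \<open>K\<close> to the unit circle is essential, that is, if it has no
  continuous argument. The modulus always has a continuous logarithm, so an argument is
  as good as a logarithm.
\<close>

lemma unbounded_component_iff_log_branch:
  fixes K :: "complex set"
  assumes "compact K" "0 \<notin> K"
  shows "\<not> bounded (connected_component_set (- K) 0) \<longleftrightarrow> (\<exists>g. log_branch (\<lambda>z. z) K g)"
proof -
  have "\<not> bounded (connected_component_set (- K) 0) \<longleftrightarrow>
      (\<exists>g. continuous_on K g \<and> (\<forall>x\<in>K. inverse (norm (x - 0)) *\<^sub>R (x - 0) = exp (\<i> * of_real (g x))))"
    using Borsuk_map_essential_bounded_component[OF assms]
      inessential_eq_continuous_logarithm_circle[of K "\<lambda>x. inverse (norm (x - 0)) *\<^sub>R (x - 0)"]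
    by auto
  also have "\<dots> \<longleftrightarrow> (\<exists>g. log_branch (\<lambda>z. z) K g)"
  proof
    assume "\<exists>g. continuous_on K g \<and>
      (\<forall>x\<in>K. inverse (norm (x - 0)) *\<^sub>R (x - 0) = exp (\<i> * of_real (g x)))"
    then obtain g where g: "continuous_on K g"
      "\<And>x. x \<in> K \<Longrightarrow> inverse (norm x) *\<^sub>R x = exp (\<i> * of_real (g x))" by auto
    have "x = exp (of_real (ln (norm x)) + \<i> * of_real (g x))" if "x \<in> K" for x
    proof -
      have "x \<noteq> 0" using that assms by auto
      then have "exp (of_real (ln (norm x)) :: complex) = of_real (norm x)"
        by (metis exp_ln exp_of_real zero_less_norm_iff)
      then show ?thesis using \<open>x \<noteq> 0\<close>
        by (simp add: exp_add g(2)[OF that, symmetric] scaleR_conv_of_real)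
    qed
    moreover have "continuous_on K (\<lambda>x. of_real (ln (norm x)) + \<i> * of_real (g x))"
      using assms by (intro continuous_intros g) auto
    ultimately show "\<exists>g. log_branch (\<lambda>z. z) K g"
      unfolding log_branch_def by blast
  next
    assume "\<exists>g. log_branch (\<lambda>z. z) K g"
    then obtain g where g: "continuous_on K g" "\<And>x. x \<in> K \<Longrightarrow> x = exp (g x)"
      unfolding log_branch_def by blast
    have "inverse (norm x) *\<^sub>R x = exp (\<i> * of_real (Im (g x)))" if "x \<in> K" for x
    proof -
      have "inverse (norm x) *\<^sub>R x = inverse (norm (exp (g x))) *\<^sub>R exp (g x)"
        using g(2)[OF that] by simp
      also have "\<dots> = inverse (exp (Re (g x))) *\<^sub>R (exp (Re (g x)) *\<^sub>R exp (\<i> * of_real (Im (g x))))"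
        by (simp add: exp_eq_polar[of "g x"] norm_mult scaleR_conv_of_real cis_conv_exp)
      also have "\<dots> = exp (\<i> * of_real (Im (g x)))" by simp
      finally show ?thesis .
    qed
    moreover have "continuous_on K (\<lambda>x. Im (g x))"
      by (intro continuous_intros g)
    ultimately show "\<exists>g. continuous_on K g \<and>
      (\<forall>x\<in>K. inverse (norm (x - 0)) *\<^sub>R (x - 0) = exp (\<i> * of_real (g x)))"
      by (intro exI[of _ "\<lambda>x. Im (g x)"]) auto
  qed
  finally show ?thesis .
qed

lemma stereographic_projection_ex:
  assumes "p \<in> S2" "q \<in> S2" "p \<noteq> q"
  obtains \<phi> \<psi> where "homeomorphism (S2 - {q}) (UNIV :: complex set) \<phi> \<psi>" "\<phi> p = 0"
proof -
  have "(S2 - {q}) homeomorphic (UNIV :: complex set)"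
    using homeomorphic_punctured_affine_sphere_affine[of 1 q 0 UNIV "UNIV :: complex set"] assms
    by auto
  then obtain f g where fg: "homeomorphism (S2 - {q}) (UNIV :: complex set) f g"
    unfolding homeomorphic_def by blast
  have "homeomorphism (UNIV :: complex set) UNIV (\<lambda>z. z - f p) (\<lambda>z. z + f p)"
    by (auto simp: homeomorphism_def intro!: continuous_intros surjI[of _ "\<lambda>z. z + f p"]
        surjI[of _ "\<lambda>z. z - f p"])
  from homeomorphism_compose[OF fg this] show ?thesis
    using that[of "(\<lambda>z. z - f p) \<circ> f"] by auto
qed

text \<open>
  Stereographic projection from \<open>q\<close> turns neighbourhoods of \<open>q\<close> into neighbourhoods of infinity. Hence
  the preimage of an unbounded component has \<open>q\<close> in its closure, while the preimage of a
  bounded one stays away from \<open>q\<close> and is open and closed in the complement of \<open>K\<close>.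
\<close>

lemma connected_component_sphere_iff_unbounded:
  assumes hom: "homeomorphism (S2 - {q}) (UNIV :: complex set) \<phi> \<psi>" and q: "q \<in> S2"
    and K: "compact K" "K \<subseteq> S2 - {p, q}" and p: "p \<in> S2" "p \<noteq> q"
  shows "connected_component (S2 - K) p q \<longleftrightarrow>
         \<not> bounded (connected_component_set (- \<phi> ` K) (\<phi> p))"
proof -
  define W where "W = connected_component_set (- \<phi> ` K) (\<phi> p)"
  have \<psi>\<phi>: "\<And>x. x \<in> S2 - {q} \<Longrightarrow> \<psi> (\<phi> x) = x" and \<phi>\<psi>: "\<And>z. \<phi> (\<psi> z) = z"
    and \<psi>UNIV: "range \<psi> = S2 - {q}"
    and con\<phi>: "continuous_on (S2 - {q}) \<phi>" and con\<psi>: "continuous_on UNIV \<psi>"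
    using hom by (auto simp: homeomorphism_def)
  have \<psi>im: "\<psi> z \<in> S2 - {q}" for z
    using \<psi>UNIV by (metis rangeI)
  have con\<psi>': "continuous_on X \<psi>" for X
    using con\<psi> continuous_on_subset by blast
  have "compact (\<phi> ` K)"
    using K con\<phi> by (intro compact_continuous_image) (auto elim: continuous_on_subset)
  then have opK: "open (- \<phi> ` K)" using compact_imp_closed by blast
  have "\<phi> p \<notin> \<phi> ` K"
  proof
    assume "\<phi> p \<in> \<phi> ` K"
    then obtain y where y: "y \<in> K" "\<phi> p = \<phi> y" by blast
    then have "\<psi> (\<phi> y) = y" "\<psi> (\<phi> p) = p" using \<psi>\<phi> K(2) p by blast+
    then show False using K y by auto
  qed
  then have pW: "\<phi> p \<in> W"
    unfolding W_def by simp
  have opW: "open W" unfolding W_def using opK by (rule open_connected_component)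
  have Wsub: "W \<subseteq> - \<phi> ` K" unfolding W_def by (rule connected_component_subset)
  have \<psi>W: "\<psi> ` W \<subseteq> S2 - K - {q}"
  proof
    fix y assume "y \<in> \<psi> ` W"
    then obtain z where z: "z \<in> W" "y = \<psi> z" by blast
    then have "y \<notin> K" using Wsub \<phi>\<psi>[of z] by (metis ComplD image_eqI subsetD)
    then show "y \<in> S2 - K - {q}" using \<psi>im[of z] z by blast
  qed
  have p\<psi>: "p \<in> \<psi> ` W" using pW \<psi>\<phi>[of p] p by (intro image_eqI[of _ \<psi> "\<phi> p"]) simp_all
  have "connected W"
    unfolding W_def by (rule connected_connected_component)
  then have conW: "connected (\<psi> ` W)"
    by (rule connected_continuous_image[OF con\<psi>'])
  have "connected_component (S2 - K) p q \<longleftrightarrow> \<not> bounded W"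
  proof
    assume unb: "\<not> bounded W"
    \<comment> \<open>Otherwise that closure is a compact subset of the domain of \<open>\<phi>\<close>, so \<open>W\<close> is bounded.\<close>
    have "q \<in> closure (\<psi> ` W)"
    proof (rule ccontr)
      assume nq: "q \<notin> closure (\<psi> ` W)"
      have "closure (\<psi> ` W) \<subseteq> S2"
        using \<psi>W by (intro closure_minimal) auto
      then have sub: "closure (\<psi> ` W) \<subseteq> S2 - {q}"
        using nq by auto
      have "bounded (\<psi> ` W)"
        using \<psi>W by (intro bounded_subset[OF bounded_sphere, of _ 0 1]) auto
      then have "compact (\<phi> ` closure (\<psi> ` W))"
        using continuous_on_subset[OF con\<phi> sub]
        by (intro compact_continuous_image) (simp_all add: compact_closure)
      then have "bounded (\<phi> ` closure (\<psi> ` W))"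
        by (rule compact_imp_bounded)
      moreover have "W \<subseteq> \<phi> ` closure (\<psi> ` W)"
      proof
        fix z assume "z \<in> W"
        then have "\<psi> z \<in> closure (\<psi> ` W)"
          by (intro subsetD[OF closure_subset] imageI)
        then show "z \<in> \<phi> ` closure (\<psi> ` W)"
          by (rule image_eqI[rotated]) (simp add: \<phi>\<psi>)
      qed
      ultimately show False using unb by (blast dest: bounded_subset)
    qed
    then have "insert q (\<psi> ` W) \<subseteq> closure (\<psi> ` W)"
      using closure_subset[of "\<psi> ` W"] by blast
    then have "connected (insert q (\<psi> ` W))"
      by (rule connected_intermediate_closure[OF conW subset_insertI])
    moreover have "insert q (\<psi> ` W) \<subseteq> S2 - K" using \<psi>W K(2) q by blast
    ultimately show "connected_component (S2 - K) p q"
      unfolding connected_component_def using p\<psi> by blast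
  next
    assume "connected_component (S2 - K) p q"
    then obtain C where C: "connected C" "C \<subseteq> S2 - K" "p \<in> C" "q \<in> C"
      unfolding connected_component_def by blast
    show "\<not> bounded W"
    proof
      assume bd: "bounded W"
      \<comment> \<open>The preimage of \<open>W\<close> is clopen in the complement of \<open>K\<close>, so \<open>C\<close> cannot leave it.\<close>
      have "openin (top_of_set (S2 - {q})) (\<psi> ` W)"
      proof -
        have "openin (top_of_set UNIV) W" using opW by simp
        from homeomorphism_imp_open_map[OF homeomorphism_symD[OF hom] this] show ?thesis .
      qed
      then have "openin (top_of_set S2) (\<psi> ` W)"
        by (rule openin_trans) (simp add: openin_delete)
      then obtain O1 where O1: "open O1" "\<psi> ` W = S2 \<inter> O1" by (auto simp: openin_open)
      have "compact (\<psi> ` closure W)"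
        using bd by (intro compact_continuous_image con\<psi>') simp
      then have cl: "closed (\<psi> ` closure W)" by (rule compact_imp_closed)
      have clW: "closure W \<subseteq> W \<union> \<phi> ` K"
      proof -
        have "closedin (top_of_set (- \<phi> ` K)) W"
          unfolding W_def by (rule closedin_connected_component)
        then obtain F where F: "closed F" "W = - \<phi> ` K \<inter> F"
          by (auto simp: closedin_closed)
        then have "closure W \<subseteq> F" by (intro closure_minimal) auto
        then show ?thesis using F by blast
      qed
      have sub: "\<psi> ` closure W \<inter> (S2 - K) \<subseteq> \<psi> ` W"
      proof
        fix y assume y: "y \<in> \<psi> ` closure W \<inter> (S2 - K)"
        then obtain z where z: "z \<in> closure W" "y = \<psi> z" by blast
        have "z \<notin> \<phi> ` K"
        proof
          assume "z \<in> \<phi> ` K"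
          then obtain u where "u \<in> K" "z = \<phi> u" by blast
          moreover from this have "u \<in> S2 - {q}" using K(2) by blast
          ultimately have "y = u" using z \<psi>\<phi>[of u] by simp
          then show False using y \<open>u \<in> K\<close> by blast
        qed
        then show "y \<in> \<psi> ` W" using z clW by blast
      qed
      have "C \<inter> O1 \<inter> - (\<psi> ` closure W) = {}"
        using O1 C closure_subset[of W] by blast
      moreover have "C \<subseteq> O1 \<union> - (\<psi> ` closure W)"
        using sub C O1 by blast
      moreover have "p \<in> O1" using p\<psi> O1 by blast
      moreover have "q \<in> - (\<psi> ` closure W)" using \<psi>im by blast
      ultimately show False
        using connectedD[OF C(1) O1(1), of "- (\<psi> ` closure W)"] cl C by blast
    qed
  qed
  then show ?thesis unfolding W_def .
qed

text \<open>
  The criterion on which the whole proof rests: not being separated by \<open>K\<close> becomes the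
  existence of a function on \<open>K\<close>, and functions can be glued.
\<close>

lemma connected_component_sphere_iff_log_branch:
  assumes hom: "homeomorphism (S2 - {q}) (UNIV :: complex set) \<phi> \<psi>" and "q \<in> S2"
    and K: "compact K" "K \<subseteq> S2 - {p, q}" and p: "p \<in> S2" "p \<noteq> q" "\<phi> p = 0"
  shows "connected_component (S2 - K) p q \<longleftrightarrow> (\<exists>g. log_branch \<phi> K g)"
proof -
  have \<psi>\<phi>: "\<And>x. x \<in> S2 - {q} \<Longrightarrow> \<psi> (\<phi> x) = x" and con\<phi>: "continuous_on (S2 - {q}) \<phi>"
    and con\<psi>: "continuous_on UNIV \<psi>"
    using hom by (auto simp: homeomorphism_def)
  have con: "continuous_on K \<phi>" "continuous_on (\<phi> ` K) \<psi>"
    using con\<phi> con\<psi> K by (auto elim: continuous_on_subset)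
  have inv: "\<psi> (\<phi> x) = x" if "x \<in> K" for x using \<psi>\<phi> K that by blast
  have "compact (\<phi> ` K)" using K con by (intro compact_continuous_image)
  moreover have "0 \<notin> \<phi> ` K"
  proof
    assume "0 \<in> \<phi> ` K"
    then obtain y where y: "y \<in> K" "\<phi> p = \<phi> y" using p by auto
    then have "\<psi> (\<phi> y) = y" "\<psi> (\<phi> p) = p" using \<psi>\<phi> K(2) p by blast+
    then show False using K y by auto
  qed
  ultimately have "connected_component (S2 - K) p q \<longleftrightarrow> (\<exists>g. log_branch (\<lambda>z. z) (\<phi> ` K) g)"
    using connected_component_sphere_iff_unbounded[OF assms(1-6)]
      unbounded_component_iff_log_branch[of "\<phi> ` K"] p by simp
  also have "\<dots> \<longleftrightarrow> (\<exists>g. log_branch \<phi> K g)"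
  proof
    assume "\<exists>g. log_branch (\<lambda>z. z) (\<phi> ` K) g"
    then obtain g where g: "log_branch (\<lambda>z. z) (\<phi> ` K) g" ..
    from log_branch_compose[OF this con(1)] show "\<exists>g. log_branch \<phi> K g"
      by (auto simp: o_def)
  next
    assume "\<exists>g. log_branch \<phi> K g"
    then obtain g where g: "log_branch \<phi> K g" ..
    have "log_branch (\<phi> \<circ> \<psi>) (\<phi> ` K) (g \<circ> \<psi>)"
      using con inv by (intro log_branch_compose[OF g]) auto
    moreover have "(\<phi> \<circ> \<psi>) z = z" if "z \<in> \<phi> ` K" for z
      using inv that by fastforce
    ultimately have "log_branch (\<lambda>z. z) (\<phi> ` K) (g \<circ> \<psi>)"
      unfolding log_branch_def by simp
    then show "\<exists>g. log_branch (\<lambda>z. z) (\<phi> ` K) g"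
      by (intro exI[of _ "g \<circ> \<psi>"])
  qed
  finally show ?thesis .
qed

section \<open>Jordan curves and lifted crossings\<close>

lemma connected_simple_loop_minus_point:
  assumes "simple_path c" "pathfinish c = pathstart c" "x \<in> path_image c"
  shows "connected (path_image c - {x})"
proof -
  obtain t where t: "t \<in> {0..1}" "x = c t" using assms by (auto simp: path_image_def)
  have "pathstart (shiftpath t c) = x" "pathfinish (shiftpath t c) = x"
    using t assms by (auto simp: pathstart_shiftpath pathfinish_shiftpath)
  then show ?thesis
    using connected_simple_path_endless[OF simple_path_shiftpath[OF assms(1,2), of t]]
      path_image_shiftpath[of t c] assms t by auto
qed

text \<open>
  Without its point \<open>x\<close>, the second curve is connected and misses the first, so it stays on one side
  of it. But near \<open>x\<close> the two sides of the first curve are \<open>P\<close> and \<open>N\<close>, since each point of a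
  Jordan curve is in the frontier of both sides, and the second curve visits both.
\<close>

lemma jordan_curves_not_single_crossing:
  fixes c1 c2 :: "real \<Rightarrow> complex"
  assumes c1: "simple_path c1" "pathfinish c1 = pathstart c1"
    and c2: "simple_path c2" "pathfinish c2 = pathstart c2"
    and single: "path_image c1 \<inter> path_image c2 = {x}"
    and V: "open V" "x \<in> V" "V - path_image c1 = P \<union> N" "connected P" "connected N"
    and meets: "path_image c2 \<inter> P \<noteq> {}" "path_image c2 \<inter> N \<noteq> {}"
  shows False
proof -
  let ?I = "inside (path_image c1)" and ?O = "outside (path_image c1)"
  have J: "open ?I" "open ?O" "?I \<inter> ?O = {}" "?I \<union> ?O = - path_image c1"
      "frontier ?I = path_image c1" "frontier ?O = path_image c1"
    using Jordan_inside_outside[OF c1] by auto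
  have side: "X \<subseteq> ?I \<or> X \<subseteq> ?O" if "connected X" "X \<inter> path_image c1 = {}" for X
    using connectedD[OF that(1) J(1,2)] J(3,4) that(2) by blast
  have "x \<in> closure ?I" "x \<in> closure ?O"
    using single J by (auto simp: frontier_def)
  then have VI: "V \<inter> ?I \<noteq> {}" "V \<inter> ?O \<noteq> {}"
    using V(1,2) by (meson disjoint_iff open_Int_closure_eq_empty)+
  have "connected (path_image c2 - {x})"
    using connected_simple_loop_minus_point[OF c2] single by blast
  then have c2side: "path_image c2 - {x} \<subseteq> ?I \<or> path_image c2 - {x} \<subseteq> ?O"
    using single by (intro side) auto
  have "P \<inter> path_image c1 = {}" "N \<inter> path_image c1 = {}" using V(3) by auto
  then have PN: "P \<subseteq> ?I \<or> P \<subseteq> ?O" "N \<subseteq> ?I \<or> N \<subseteq> ?O"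
    using side V(4,5) by simp_all
  have "x \<notin> P" "x \<notin> N" using V(3) single by auto
  with meets obtain y z where y: "y \<in> path_image c2 - {x}" "y \<in> P"
    and z: "z \<in> path_image c2 - {x}" "z \<in> N" by auto
  have sub: "V - path_image c1 \<subseteq> P \<union> N" using V(3) by simp
  have J4: "?I \<subseteq> - path_image c1" "?O \<subseteq> - path_image c1"
    using inside_no_overlap[of "path_image c1"] outside_no_overlap[of "path_image c1"] by blast+
  have disj: "u \<in> ?I \<Longrightarrow> u \<notin> ?O" for u
    using J(3) by blast
  from c2side show False
  proof
    assume "path_image c2 - {x} \<subseteq> ?I"
    then have "y \<in> ?I" "z \<in> ?I" using y z by (simp_all add: subset_iff)
    then have "P \<subseteq> ?I" "N \<subseteq> ?I" using PN y(2) z(2) disj by (meson subsetD)+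
    then have "V \<inter> ?O = {}" using sub J4(2) disj by blast
    then show False using VI(2) by simp
  next
    assume "path_image c2 - {x} \<subseteq> ?O"
    then have "y \<in> ?O" "z \<in> ?O" using y z by (simp_all add: subset_iff)
    then have "P \<subseteq> ?O" "N \<subseteq> ?O" using PN y(2) z(2) disj by (meson subsetD)+
    then have "V \<inter> ?I = {}" using sub J4(1) disj by blast
    then show False using VI(1) by simp
  qed
qed

text \<open>
  The chart of the crossing, shrunk to a disc that lies in \<open>W\<close>, is contractible and therefore
  lifts to the plane. By invariance of domain its lift is an open neighbourhood of \<open>h1 x\<close>; in
  it the lift of \<open>C1\<close> is the image of a diameter, whose complement is the union of two
  half-discs, and the lift of \<open>C2\<close> contains the image of the perpendicular diameter. The set
  \<open>W\<close> serves to keep the rest of \<open>C1\<close> away from the crossing.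
\<close>

lemma crossing_lifts:
  assumes hom: "homeomorphism (S2 - {q}) (UNIV :: complex set) \<phi> \<psi>" and p: "p \<in> S2" "p \<noteq> q" "\<phi> p = 0"
    and C: "C1 \<subseteq> S2 - {p, q}" "C2 \<subseteq> S2 - {p, q}"
    and h: "log_branch \<phi> C1 h1" "log_branch \<phi> C2 h2" "h1 x = h2 x"
    and cr: "crossing_at A B x"
    and W: "openin (top_of_set S2) W" "x \<in> W" "W \<subseteq> S2 - {p, q}"
    and A: "A \<subseteq> C1" "C1 \<inter> W \<subseteq> A" and B: "B \<subseteq> C2"
  obtains V P N where "open V" "h1 x \<in> V" "V - h1 ` C1 = P \<union> N" "connected P" "connected N"
    "h2 ` C2 \<inter> P \<noteq> {}" "h2 ` C2 \<inter> N \<noteq> {}"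
proof -
  obtain U h k where U: "openin (top_of_set S2) U" "x \<in> U"
      and hk: "homeomorphism U (ball (0::complex) 1) h k" and hx: "h x = 0"
      and hA: "h ` (A \<inter> U) = {z \<in> ball 0 1. Im z = 0}"
      and hB: "h ` (B \<inter> U) = {z \<in> ball 0 1. Re z = 0}"
    using cr unfolding crossing_at_def by blast
  have inj\<phi>: "inj_on \<phi> (S2 - {q})" and con\<phi>: "continuous_on (S2 - {q}) \<phi>"
    using hom by (auto simp: homeomorphism_def intro: inj_on_inverseI)
  have kh: "\<And>y. y \<in> U \<Longrightarrow> k (h y) = y" and hk': "\<And>z. z \<in> ball 0 1 \<Longrightarrow> h (k z) = z"
    and conk: "continuous_on (ball 0 1) k"
    using hk unfolding homeomorphism_def by blast+
  have "openin (top_of_set U) (W \<inter> U)"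
    using openin_Int[OF W(1) U(1)] openin_imp_subset[OF U(1)]
    by (rule openin_subset_trans[OF _ Int_lower2])
  from homeomorphism_imp_open_map[OF hk this]
  have "open (h ` (W \<inter> U))" by (simp add: openin_open_eq)
  moreover have "0 \<in> h ` (W \<inter> U)" using hx W(2) U(2) by (intro image_eqI[of _ h x]) simp_all
  ultimately obtain r0 where r0: "r0 > 0" "ball 0 r0 \<subseteq> h ` (W \<inter> U)"
    using open_contains_ball by blast
  define r where "r = min r0 1"
  define D where "D = ball (0::complex) r"
  have r: "0 < r" "r \<le> 1" and D: "D \<subseteq> h ` (W \<inter> U)" "D \<subseteq> ball 0 1"
    using r0 by (auto simp: r_def D_def)
  have kD: "k z \<in> W" "k z \<in> U" "k z \<in> S2 - {q}" "k z \<noteq> p" if zD: "z \<in> D" for z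
  proof -
    obtain y where "y \<in> W" "y \<in> U" "z = h y" using zD D(1) by blast
    then show "k z \<in> W" "k z \<in> U" using kh[of y] by simp_all
    then show "k z \<in> S2 - {q}" "k z \<noteq> p" using W(3) by blast+
  qed
  have contk: "continuous_on D k" using conk D continuous_on_subset by blast
  have cont: "continuous_on D (\<phi> \<circ> k)"
    using kD(3) by (intro continuous_on_compose contk continuous_on_subset[OF con\<phi>]) (rule image_subsetI)
  have inj: "inj_on (\<phi> \<circ> k) D"
  proof (rule comp_inj_on)
    show "inj_on k D" using D(2) hk' by (intro inj_on_inverseI[of _ h]) (rule hk', rule subsetD)
    show "inj_on \<phi> (k ` D)" using kD(3) by (intro inj_on_subset[OF inj\<phi>] image_subsetI)
  qed
  have "(\<phi> \<circ> k) z \<noteq> 0" if "z \<in> D" for z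
  proof
    assume "(\<phi> \<circ> k) z = 0"
    then have "k z = p" using inj_onD[OF inj\<phi>, of "k z" p] kD(3) p that by simp
    then show False using kD(4) that by simp
  qed
  moreover have k0: "k 0 = x" using kh[OF U(2)] hx by simp
  moreover have "x \<in> A"
  proof -
    have "0 \<in> h ` (A \<inter> U)" unfolding hA by simp
    then obtain u where "u \<in> A" "u \<in> U" "h u = 0" by auto
    then show ?thesis using kh[of u] k0 by simp
  qed
  then have "\<phi> x = exp (h1 x)" using h(1) A unfolding log_branch_def by blast
  ultimately obtain l where l: "log_branch (\<phi> \<circ> k) D l" "l 0 = h1 x"
    using log_branch_contractible_ex[OF cont, of 0 "h1 x"] r(1)
    by (force simp: D_def convex_imp_contractible)
  have lexp: "\<phi> (k z) = exp (l z)" if "z \<in> D" for z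
    using l that by (auto simp: log_branch_def)
  have injl: "inj_on l D"
  proof (rule inj_onI)
    fix z w assume "z \<in> D" "w \<in> D" "l z = l w"
    moreover from this have "(\<phi> \<circ> k) z = (\<phi> \<circ> k) w" by (simp add: lexp)
    ultimately show "z = w" using inj_onD[OF inj, of z w] by simp
  qed
  have conl: "continuous_on D l" using l by (simp add: log_branch_def)
  define Ix where "Ix = {z \<in> D. Im z = 0}"
  define Jx where "Jx = {z \<in> D. Re z = 0}"
  have convD: "convex D" by (simp add: D_def)
  have cx: "convex Ix" "convex Jx"
    "convex {z \<in> D. Im z > 0}" "convex {z \<in> D. Im z < 0}"
  proof -
    have "Ix = D \<inter> {z. Im z = 0}" "Jx = D \<inter> {z. Re z = 0}"
      "{z \<in> D. Im z > 0} = D \<inter> {z. Im z > 0}" "{z \<in> D. Im z < 0} = D \<inter> {z. Im z < 0}"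
      by (auto simp: Ix_def Jx_def)
    moreover have "convex {z. Im z = 0}" "convex {z. Re z = 0}"
      using convex_hyperplane[of \<i> 0] convex_hyperplane[of "1 :: complex" 0] by simp_all
    ultimately show "convex Ix" "convex Jx" "convex {z \<in> D. Im z > 0}" "convex {z \<in> D. Im z < 0}"
      by (simp_all add: convD convex_Int convex_halfspace_Im_gt convex_halfspace_Im_lt)
  qed
  have onI: "h1 (k z) = l z" and kI: "k z \<in> C1" if "z \<in> Ix" for z
  proof -
    have kIx: "k ` Ix \<subseteq> C1"
    proof
      fix y assume "y \<in> k ` Ix"
      then obtain z where z: "z \<in> Ix" "y = k z" by blast
      then have "z \<in> h ` (A \<inter> U)" unfolding hA using D(2) by (simp add: Ix_def subset_iff)
      then obtain u where "u \<in> A" "u \<in> U" "z = h u" by blast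
      then show "y \<in> C1" using z(2) kh[of u] A(1) by auto
    qed
    then show "k z \<in> C1" using that by blast
    have "log_branch (\<phi> \<circ> k) Ix (h1 \<circ> k)"
      using kIx by (intro log_branch_compose[OF h(1)] continuous_on_subset[OF contk])
        (auto simp: Ix_def)
    moreover have "log_branch (\<phi> \<circ> k) Ix l"
      using log_branch_subset[OF l(1)] by (auto simp: Ix_def)
    ultimately have "(h1 \<circ> k) z = l z"
      using log_branch_unique[OF _ _ convex_connected[OF cx(1)], of "\<phi> \<circ> k" "h1 \<circ> k" l 0 z]
        that l(2) k0 r(1) by (simp add: Ix_def D_def)
    then show "h1 (k z) = l z" by simp
  qed
  have onJ: "l z \<in> h2 ` C2" if "z \<in> Jx" for z
  proof -
    have kJx: "k ` Jx \<subseteq> C2"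
    proof
      fix y assume "y \<in> k ` Jx"
      then obtain z where z: "z \<in> Jx" "y = k z" by blast
      then have "z \<in> h ` (B \<inter> U)" unfolding hB using D(2) by (simp add: Jx_def subset_iff)
      then obtain u where "u \<in> B" "u \<in> U" "z = h u" by blast
      then show "y \<in> C2" using z(2) kh[of u] B by auto
    qed
    have "log_branch (\<phi> \<circ> k) Jx (h2 \<circ> k)"
      using kJx by (intro log_branch_compose[OF h(2)] continuous_on_subset[OF contk])
        (auto simp: Jx_def)
    moreover have "log_branch (\<phi> \<circ> k) Jx l"
      using log_branch_subset[OF l(1)] by (auto simp: Jx_def)
    ultimately have "(h2 \<circ> k) z = l z"
      using log_branch_unique[OF _ _ convex_connected[OF cx(2)], of "\<phi> \<circ> k" "h2 \<circ> k" l 0 z]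
        that l(2) h(3) k0 r(1) by (simp add: Jx_def D_def)
    moreover have "k z \<in> C2" using kJx that by blast
    ultimately show ?thesis by (intro image_eqI[of _ h2 "k z"]) simp_all
  qed
  \<comment> \<open>\<open>C1\<close> meets the image of the disc only in \<open>A\<close>, hence only in the real diameter.\<close>
  have real_iff: "l z \<in> h1 ` C1 \<longleftrightarrow> Im z = 0" if z: "z \<in> D" for z
  proof
    assume "l z \<in> h1 ` C1"
    then obtain y where y: "y \<in> C1" "l z = h1 y" by blast
    then have "\<phi> (k z) = \<phi> y" using lexp[OF z] h(1) unfolding log_branch_def by auto
    moreover have "y \<in> S2 - {q}" using C(1) y(1) by blast
    ultimately have "k z = y" using inj_onD[OF inj\<phi>, of "k z" y] kD(3)[OF z] by blast
    then have "k z \<in> A \<inter> U" using A(2) y(1) kD(1,2)[OF z] by blast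
    then have "h (k z) \<in> h ` (A \<inter> U)" by blast
    moreover have "h (k z) = z" using hk' D(2) z by blast
    ultimately show "Im z = 0" unfolding hA by simp
  next
    assume "Im z = 0"
    then show "l z \<in> h1 ` C1" 
      using onI[of z] kI[of z] z by (intro image_eqI[of _ h1 "k z"]) (simp_all add: Ix_def)
  qed
  show ?thesis
  proof
    show "open (l ` D)"
      by (rule invariance_of_domain_gen[OF _ conl injl]) (auto simp: D_def)
    show "h1 x \<in> l ` D" 
      using l(2) r(1) by (intro image_eqI[of _ l 0]) (simp_all add: D_def)
    show "l ` D - h1 ` C1 = l ` {z \<in> D. Im z > 0} \<union> l ` {z \<in> D. Im z < 0}"
    proof (intro equalityI subsetI)
      fix w assume "w \<in> l ` D - h1 ` C1"
      then obtain z where z: "z \<in> D" "w = l z" "l z \<notin> h1 ` C1" by blast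
      then have "Im z > 0 \<or> Im z < 0" using real_iff by auto
      then show "w \<in> l ` {z \<in> D. Im z > 0} \<union> l ` {z \<in> D. Im z < 0}" using z by blast
    next
      fix w assume "w \<in> l ` {z \<in> D. Im z > 0} \<union> l ` {z \<in> D. Im z < 0}"
      then obtain z where "z \<in> D" "w = l z" "Im z \<noteq> 0" by fastforce
      then show "w \<in> l ` D - h1 ` C1" using real_iff[of z] by simp
    qed
    show "connected (l ` {z \<in> D. Im z > 0})" "connected (l ` {z \<in> D. Im z < 0})"
      by (intro connected_continuous_image continuous_on_subset[OF conl] convex_connected cx; blast)+
    have "\<i> * of_real (r / 2) \<in> Jx" "\<i> * of_real (- r / 2) \<in> Jx"
      using r by (auto simp: Jx_def D_def norm_mult)
    with onJ have "l (\<i> * of_real (r / 2)) \<in> h2 ` C2" "l (\<i> * of_real (- r / 2)) \<in> h2 ` C2"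
      by blast+
    moreover have "\<i> * of_real (r / 2) \<in> {z \<in> D. Im z > 0}" "\<i> * of_real (- r / 2) \<in> {z \<in> D. Im z < 0}"
      using r by (auto simp: D_def norm_mult)
    ultimately show "h2 ` C2 \<inter> l ` {z \<in> D. Im z > 0} \<noteq> {}" "h2 ` C2 \<inter> l ` {z \<in> D. Im z < 0} \<noteq> {}"
      by blast+
  qed
qed

text \<open>
  That the loops meet again is no surprise; the point is that they do so with the same values of
  the logarithm. The reason is that \<open>h1\<close> and \<open>h2\<close> map them to Jordan curves in the plane, which
  cross at the common point \<open>h1 x = h2 x\<close> and so cannot have only this point in common.
\<close>

lemma lifted_loops_not_single_crossing:
  assumes hom: "homeomorphism (S2 - {q}) (UNIV :: complex set) \<phi> \<psi>" and p: "p \<in> S2" "p \<noteq> q" "\<phi> p = 0"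
    and c1: "simple_path c1" "pathfinish c1 = pathstart c1" "path_image c1 \<subseteq> S2 - {p, q}"
    and c2: "simple_path c2" "pathfinish c2 = pathstart c2" "path_image c2 \<subseteq> S2 - {p, q}"
    and h: "log_branch \<phi> (path_image c1) h1" "log_branch \<phi> (path_image c2) h2"
    and x: "x \<in> path_image c1" "x \<in> path_image c2" "h1 x = h2 x"
    and cr: "crossing_at A B x"
    and W: "openin (top_of_set S2) W" "x \<in> W"
    and A: "A \<subseteq> path_image c1" "path_image c1 \<inter> W \<subseteq> A" and B: "B \<subseteq> path_image c2"
  shows "\<exists>y \<in> path_image c1 \<inter> path_image c2. h1 y = h2 y \<and> y \<noteq> x"
proof (rule ccontr)
  assume "\<not> ?thesis"
  then have only: "y = x" if "y \<in> path_image c1" "y \<in> path_image c2" "h1 y = h2 y" for y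
    using that by blast
  have inj\<phi>: "inj_on \<phi> (S2 - {q})"
    using hom by (auto simp: homeomorphism_def intro: inj_on_inverseI)
  have lift: "simple_path (h \<circ> c)" "pathfinish (h \<circ> c) = pathstart (h \<circ> c)" "inj_on h (path_image c)"
    if c: "simple_path c" "pathfinish c = pathstart c" "path_image c \<subseteq> S2 - {p, q}"
      and h: "log_branch \<phi> (path_image c) h" for h c
  proof -
    show inj: "inj_on h (path_image c)"
    proof (rule inj_onI)
      fix y z assume yz: "y \<in> path_image c" "z \<in> path_image c" "h y = h z"
      then have "\<phi> y = \<phi> z" using h by (simp add: log_branch_def)
      then show "y = z" using yz c(3) inj_onD[OF inj\<phi>, of y z] by blast
    qed
    show "simple_path (h \<circ> c)"
      using c h inj by (intro simple_path_continuous_image) (simp_all add: log_branch_def)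
    show "pathfinish (h \<circ> c) = pathstart (h \<circ> c)"
      using c(2) by (simp add: pathfinish_def pathstart_def)
  qed
  have "W - {p, q} = W - {q} - {p}" by blast
  then have W1: "openin (top_of_set S2) (W - {p, q})"
    using openin_delete[OF openin_delete[OF W(1)]] by (simp only:)
  have W2: "x \<in> W - {p, q}" "W - {p, q} \<subseteq> S2 - {p, q}"
    using W c1(3) x(1) openin_imp_subset[OF W(1)] by blast+
  have W3: "path_image c1 \<inter> (W - {p, q}) \<subseteq> A" using A(2) by blast
  obtain V P N where V: "open V" "h1 x \<in> V" "V - h1 ` path_image c1 = P \<union> N" "connected P" "connected N"
      "h2 ` path_image c2 \<inter> P \<noteq> {}" "h2 ` path_image c2 \<inter> N \<noteq> {}"
    by (rule crossing_lifts[OF hom p c1(3) c2(3) h x(3) cr W1 W2 A(1) W3 B])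
  have "h1 ` path_image c1 \<inter> h2 ` path_image c2 = {h1 x}"
  proof (intro equalityI subsetI)
    fix z assume "z \<in> h1 ` path_image c1 \<inter> h2 ` path_image c2"
    then obtain y y' where y: "y \<in> path_image c1" "z = h1 y" "y' \<in> path_image c2" "z = h2 y'" by blast
    then have "\<phi> y = \<phi> y'" using h by (simp add: log_branch_def)
    then have "y = y'" using y c1(3) c2(3) inj_onD[OF inj\<phi>, of y y'] by blast
    then show "z \<in> {h1 x}" using only[of y] y by simp
  next
    fix z assume "z \<in> {h1 x}"
    then have "z = h1 x" "z = h2 x" using x(3) by simp_all
    then show "z \<in> h1 ` path_image c1 \<inter> h2 ` path_image c2" using x(1,2) by blast
  qed
  then show False
    using jordan_curves_not_single_crossing[OF lift(1,2)[OF c1 h(1)] lift(1,2)[OF c2 h(2)], of "h1 x" V P N] V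
    by (simp add: path_image_compose)
qed

section \<open>Edges and 3-cycles of a simple drawing\<close>

lemma edge_nsets_iff: "e \<in> nsets X 2 \<longleftrightarrow> (\<exists>i j. e = {i, j} \<and> i \<in> X \<and> j \<in> X \<and> i \<noteq> j)"
  by (auto simp: nsets_def card_2_iff)

lemma two_subsets_of_triple_meet:
  assumes "T \<in> nsets X 3" "e \<in> nsets T 2" "f \<in> nsets T 2"
  shows "e \<inter> f \<noteq> {}"
proof
  assume "e \<inter> f = {}"
  moreover have "finite T" "card T = 3" "e \<subseteq> T" "f \<subseteq> T" "card e = 2" "card f = 2" "finite e" "finite f"
    using assms by (auto simp: nsets_def)
  ultimately show False
    using card_mono[of T "e \<union> f"] card_Un_disjoint[of e f] by simp
qed

lemma pair_in_nsets_iff [simp]: "{i, j} \<in> nsets X 2 \<longleftrightarrow> i \<in> X \<and> j \<in> X \<and> i \<noteq> j"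
  by (cases "i = j") (auto simp: nsets_def)

lemma nsets_triple_2:
  assumes "a \<noteq> b" "b \<noteq> c" "a \<noteq> c"
  shows "nsets {a, b, c} 2 = {{a, b}, {b, c}, {a, c}}"
proof
  show "nsets {a, b, c} 2 \<subseteq> {{a, b}, {b, c}, {a, c}}"
    by (auto simp: edge_nsets_iff)
  show "{{a, b}, {b, c}, {a, c}} \<subseteq> nsets {a, b, c} 2"
    using assms by simp
qed

locale simple_drawing_Kn =
  fixes n :: nat and v :: "nat \<Rightarrow> real^3" and E :: "nat set \<Rightarrow> (real^3) set"
  assumes simple: "simple_drawing n v E"
begin

lemma drawing: "drawing n v E"
  using simple unfolding simple_drawing_def by (rule conjunct1)

lemma vertices_inj: "inj_on v (verts n)"
  using drawing unfolding drawing_def by (rule conjunct1)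

lemma edge_in_sphere: "e \<in> edges n \<Longrightarrow> E e \<subseteq> S2"
  using drawing[unfolded drawing_def, THEN conjunct2, THEN conjunct2, THEN conjunct1] by simp

lemma edge_arc_ex:
  assumes "e \<in> edges n"
  obtains g where "arc g" "path_image g = E e" "{pathstart g, pathfinish g} = v ` e"
proof -
  have "E e \<subseteq> S2 \<and> (\<exists>g. arc g \<and> path_image g = E e \<and> {pathstart g, pathfinish g} = v ` e)"
    using drawing[unfolded drawing_def, THEN conjunct2, THEN conjunct2, THEN conjunct1] assms
    by (rule bspec)
  then show ?thesis using that by blast
qed

lemma vertex_not_interior:
  assumes "e \<in> edges n" "i < n" "v i \<in> E e"
  shows "v i \<in> v ` e"
proof -
  have "v ` verts n \<inter> (E e - v ` e) = {}"
    using drawing[unfolded drawing_def, THEN conjunct2, THEN conjunct2, THEN conjunct2, THEN conjunct1]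
      assms(1) by (rule bspec)
  then show ?thesis using assms by blast
qed

lemma edges_meet:
  assumes "e \<in> edges n" "f \<in> edges n" "e \<noteq> f"
  shows "x \<in> E e \<Longrightarrow> x \<in> E f \<Longrightarrow> x \<in> v ` e \<inter> v ` f \<or> crossing_at (E e) (E f) x"
    and "\<exists>z. E e \<inter> E f \<subseteq> {z}"
proof -
  have "\<forall>f\<in>edges n. e \<noteq> f \<longrightarrow> finite (E e \<inter> E f) \<and>
      (\<forall>x\<in>E e \<inter> E f. x \<in> v ` e \<inter> v ` f \<or> crossing_at (E e) (E f) x)"
    using drawing[unfolded drawing_def, THEN conjunct2, THEN conjunct2, THEN conjunct2, THEN conjunct2]
      assms(1) by (rule bspec)
  then have "\<forall>x\<in>E e \<inter> E f. x \<in> v ` e \<inter> v ` f \<or> crossing_at (E e) (E f) x"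
    using assms(2,3) by simp
  then show "x \<in> E e \<Longrightarrow> x \<in> E f \<Longrightarrow> x \<in> v ` e \<inter> v ` f \<or> crossing_at (E e) (E f) x"
    by simp
  have "\<forall>f\<in>edges n. e \<noteq> f \<longrightarrow> (\<exists>x. E e \<inter> E f \<subseteq> {x})"
    using simple[unfolded simple_drawing_def, THEN conjunct2] assms(1) by (rule bspec)
  then show "\<exists>z. E e \<inter> E f \<subseteq> {z}" using assms(2,3) by simp
qed

lemma edge_arc:
  assumes "i < n" "j < n" "i \<noteq> j"
  obtains g where "arc g" "path_image g = E {i, j}" "pathstart g = v i" "pathfinish g = v j"
proof -
  have "{i, j} \<in> edges n" using assms by simp
  then obtain g where g: "arc g" "path_image g = E {i, j}" "{pathstart g, pathfinish g} = v ` {i, j}"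
    by (rule edge_arc_ex)
  then consider "pathstart g = v i" "pathfinish g = v j" | "pathstart g = v j" "pathfinish g = v i"
    by (auto simp: doubleton_eq_iff)
  then show ?thesis
  proof cases
    case 1
    then show ?thesis using that[OF g(1,2)] by simp
  next
    case 2
    then show ?thesis using g(1,2) that[of "reversepath g"] by (simp add: arc_reversepath)
  qed
qed

lemma edge_compact: "e \<in> edges n \<Longrightarrow> compact (E e)"
  by (metis edge_arc_ex compact_arc_image)

lemma edge_closed: "e \<in> edges n \<Longrightarrow> closed (E e)"
  by (rule compact_imp_closed[OF edge_compact])

lemma edge_connected: "e \<in> edges n \<Longrightarrow> connected (E e)"
  by (metis edge_arc_ex connected_arc_image)

lemma edge_contractible: "e \<in> edges n \<Longrightarrow> contractible (E e)"
proof -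
  assume "e \<in> edges n"
  then obtain g where g: "arc g" "path_image g = E e"
    by (rule edge_arc_ex)
  have "path_image g homeomorphic {0..1::real}"
    using homeomorphic_arc_image_interval[OF g(1), of 0 1] by simp
  then show ?thesis
    using g(2) homeomorphic_contractible_eq convex_imp_contractible[of "{0..1::real}"] by auto
qed

lemma vertex_in_edge:
  assumes "e \<in> edges n" "i \<in> e"
  shows "v i \<in> E e"
proof -
  obtain g where "path_image g = E e" "{pathstart g, pathfinish g} = v ` e"
    using assms(1) by (rule edge_arc_ex)
  moreover have "{pathstart g, pathfinish g} \<subseteq> path_image g"
    by (simp add: pathstart_in_path_image pathfinish_in_path_image)
  ultimately have "v ` e \<subseteq> E e" by simp
  then show ?thesis using assms(2) by blast
qed

lemma adjacent_edges_meet_at_vertex: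
  assumes "e \<in> edges n" "f \<in> edges n" "e \<noteq> f" "i \<in> e" "i \<in> f" "x \<in> E e" "x \<in> E f"
  shows "x = v i"
proof -
  obtain z where z: "E e \<inter> E f \<subseteq> {z}"
    using edges_meet(2)[OF assms(1-3)] ..
  have "y = z" if "y \<in> E e" "y \<in> E f" for y
    using z that by blast
  then show ?thesis using assms(6,7) vertex_in_edge assms(1,2,4,5) by metis
qed

lemma disjoint_edges_cross:
  assumes "e \<in> edges n" "f \<in> edges n" "e \<inter> f = {}" "x \<in> E e" "x \<in> E f"
  shows "crossing_at (E e) (E f) x" and "E e \<inter> E f = {x}"
proof -
  have ne: "e \<noteq> f" using assms by (auto simp: edge_nsets_iff)
  have sub: "e \<subseteq> verts n" "f \<subseteq> verts n" using assms by (auto simp: nsets_def)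
  have "v ` e \<inter> v ` f = v ` (e \<inter> f)"
    using inj_on_image_Int[OF vertices_inj sub] ..
  then have "v ` e \<inter> v ` f = {}" using assms(3) by simp
  then show "crossing_at (E e) (E f) x"
    using edges_meet(1)[OF assms(1,2) ne assms(4,5)] by simp
  obtain z where "E e \<inter> E f \<subseteq> {z}"
    using edges_meet(2)[OF assms(1,2) ne] ..
  then show "E e \<inter> E f = {x}" using assms by blast
qed

lemma vertex_on_edge_is_end:
  assumes "f \<in> edges n" "i < n" "v i \<in> E f"
  shows "i \<in> f"
proof -
  have "f \<subseteq> verts n" using assms by (auto simp: nsets_def)
  then show ?thesis
    using vertex_not_interior[OF assms] inj_on_image_mem_iff[OF vertices_inj] assms(2) by simp
qed

lemma three_cycle_edges: "T \<in> three_cycles n \<Longrightarrow> nsets T 2 \<subseteq> edges n"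
  by (auto simp: nsets_def)

lemma drawn_cycle_loop:
  assumes "T \<in> three_cycles n"
  obtains c where "simple_path c" "pathfinish c = pathstart c" "path_image c = drawn_cycle E T"
proof -
  obtain a b d where T: "T = {a, b, d}" and ne: "a \<noteq> b" "b \<noteq> d" "a \<noteq> d"
    using assms by (auto simp: nsets_def card_3_iff)
  have n: "a < n" "b < n" "d < n" using assms T by (auto simp: nsets_def)
  have e: "{a, b} \<in> edges n" "{b, d} \<in> edges n" "{a, d} \<in> edges n"
    using n ne by simp_all
  obtain g1 where g1: "arc g1" "path_image g1 = E {a, b}" "pathstart g1 = v a" "pathfinish g1 = v b"
    using edge_arc[OF n(1,2) ne(1)] .
  obtain g2 where g2: "arc g2" "path_image g2 = E {b, d}" "pathstart g2 = v b" "pathfinish g2 = v d"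
    using edge_arc[OF n(2,3) ne(2)] .
  obtain g3 where g3: "arc g3" "path_image g3 = E {d, a}" "pathstart g3 = v d" "pathfinish g3 = v a"
    using edge_arc[OF n(3,1)] ne(3) by metis
  have da: "{d, a} = {a, d}" by blast
  have m: "E {a, b} \<inter> E {b, d} \<subseteq> {v b}" "E {b, d} \<inter> E {a, d} \<subseteq> {v d}" "E {a, b} \<inter> E {a, d} \<subseteq> {v a}"
    using adjacent_edges_meet_at_vertex[OF e(1,2), of b] adjacent_edges_meet_at_vertex[OF e(2,3), of d]
      adjacent_edges_meet_at_vertex[OF e(1,3), of a] ne by (auto simp: doubleton_eq_iff)
  have "simple_path (g1 +++ g2 +++ g3)"
    using g1 g2 g3 m by (intro simple_path_join3I) (simp_all add: da)
  moreover have "path_image (g1 +++ g2 +++ g3) = drawn_cycle E T"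
  proof -
    have "nsets T 2 = {{a, b}, {b, d}, {a, d}}"
      unfolding T using ne by (rule nsets_triple_2)
    then show ?thesis
      using g1 g2 g3 by (simp add: path_image_join drawn_cycle_def da)
  qed
  moreover have "pathfinish (g1 +++ g2 +++ g3) = pathstart (g1 +++ g2 +++ g3)"
    using g1 g3 by simp
  ultimately show ?thesis using that by blast
qed

end

section \<open>Lifting a drawing\<close>

text \<open>
  Two points \<open>p\<close> and \<open>q\<close> off the drawing that no 3-cycle separates, together with a stereographic
  projection \<open>\<phi>\<close> that sends \<open>p\<close> to \<open>0\<close> and \<open>q\<close> to infinity.
\<close>

locale unseparated_pair = simple_drawing_Kn +
  fixes p q :: "real^3" and \<phi> :: "real^3 \<Rightarrow> complex" and \<psi> :: "complex \<Rightarrow> real^3"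
  assumes n3: "n \<ge> 3"
    and hom: "homeomorphism (S2 - {q}) UNIV \<phi> \<psi>"
    and p: "p \<in> S2" "p \<noteq> q" "\<phi> p = 0" and q: "q \<in> S2"
    and off: "e \<in> edges n \<Longrightarrow> E e \<subseteq> S2 - {p, q}"
    and unseparated: "T \<in> three_cycles n \<Longrightarrow> connected_component (S2 - drawn_cycle E T) p q"
begin

lemma projection_nonzero:
  assumes "e \<in> edges n" "x \<in> E e"
  shows "\<phi> x \<noteq> 0"
proof
  assume "\<phi> x = 0"
  have inv: "\<And>x. x \<in> S2 - {q} \<Longrightarrow> \<psi> (\<phi> x) = x"
    using hom by (simp add: homeomorphism_def)
  have x: "x \<in> S2 - {q}" "x \<noteq> p" using off[OF assms(1)] assms(2) by auto
  with \<open>\<phi> x = 0\<close> have "x = p" using inv[of x] inv[of p] p by simp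
  then show False using x by simp
qed

lemma edge_log:
  assumes e: "e \<in> edges n" and i: "i \<in> e" and w: "\<phi> (v i) = exp w"
  shows "\<exists>h. log_branch \<phi> (E e) h \<and> h (v i) = w"
proof -
  have "continuous_on (S2 - {q}) \<phi>" using hom by (simp add: homeomorphism_def)
  then have "continuous_on (E e) \<phi>"
    by (rule continuous_on_subset) (use off[OF e] in blast)
  then obtain h where "log_branch \<phi> (E e) h" "h (v i) = w"
    using edge_contractible[OF e] projection_nonzero[OF e] vertex_in_edge[OF e i] w
    by (rule log_branch_contractible_ex)
  then show ?thesis by blast
qed

lemma cycle_log:
  assumes T: "T \<in> three_cycles n"
  shows "\<exists>h. log_branch \<phi> (drawn_cycle E T) h"
proof -
  obtain c where "simple_path c" "path_image c = drawn_cycle E T"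
    using drawn_cycle_loop[OF T] by metis
  then have "compact (drawn_cycle E T)"
    using compact_simple_path_image by metis
  moreover have "drawn_cycle E T \<subseteq> S2 - {p, q}"
    unfolding drawn_cycle_def using three_cycle_edges[OF T] by (intro UN_least off) (rule subsetD)
  ultimately show ?thesis
    using connected_component_sphere_iff_log_branch[OF hom q _ _ p] unseparated[OF T] by simp
qed

text \<open>
  Lifting the star of edges at vertex \<open>0\<close> fixes a value \<open>L i\<close> above every vertex. The
  3-cycle \<open>{0, i, j}\<close> has a lift because it does not separate \<open>p\<close> from \<open>q\<close>; this lift agrees
  with that of the star, so the edge \<open>{i, j}\<close> has a lift with the prescribed values at both ends.
\<close>

lemma normalised_edge_logs_ex:
  "\<exists>L g. \<forall>e\<in>edges n. log_branch \<phi> (E e) (g e) \<and> (\<forall>i\<in>e. g e (v i) = L i)"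
proof -
  define w where "w = Ln (\<phi> (v 0))"
  have star: "{0, j} \<in> edges n" if "j \<in> {1..<n}" for j using that by simp
  have w: "\<phi> (v 0) = exp w"
    using projection_nonzero[OF star[of 1] vertex_in_edge[OF star[of 1], of 0]] n3
    by (simp add: w_def)
  have "\<forall>j\<in>{1..<n}. \<exists>h. log_branch \<phi> (E {0, j}) h \<and> h (v 0) = w"
    using edge_log[OF star _ w] by blast
  from bchoice[OF this] obtain s where
    s: "\<And>j. j \<in> {1..<n} \<Longrightarrow> log_branch \<phi> (E {0, j}) (s j) \<and> s j (v 0) = w" by blast
  define L where "L j = (if j = 0 then w else s j (v j))" for j
  have "\<forall>e\<in>edges n. \<exists>h. log_branch \<phi> (E e) h \<and> (\<forall>i\<in>e. h (v i) = L i)"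
  proof
    fix e assume e: "e \<in> edges n"
    then obtain i j where ij: "e = {i, j}" "i < j" "j < n"
      unfolding edge_nsets_iff by (metis insert_commute lessThan_iff linorder_less_linear)
    show "\<exists>h. log_branch \<phi> (E e) h \<and> (\<forall>i\<in>e. h (v i) = L i)"
    proof (cases "i = 0")
      case True
      then show ?thesis using ij s[of j] by (intro exI[of _ "s j"]) (simp add: L_def)
    next
      case False
      then have i: "i \<in> {1..<n}" and j: "j \<in> {1..<n}" using ij by auto
      have T: "{0, i, j} \<in> three_cycles n"
        using ij False by (simp add: nsets_def)
      obtain h0 where h0: "log_branch \<phi> (drawn_cycle E {0, i, j}) h0"
        using cycle_log[OF T] ..
      have sub: "E {a, b} \<subseteq> drawn_cycle E {0, i, j}" if "a \<in> {0, i, j}" "b \<in> {0, i, j}" "a \<noteq> b" for a b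
        unfolding drawn_cycle_def by (rule UN_upper) (use that in simp)
      have v0: "v 0 \<in> drawn_cycle E {0, i, j}"
        using subsetD[OF sub[of 0 i] vertex_in_edge[OF star[OF i], of 0]] False by simp
      define h where "h x = h0 x + (w - h0 (v 0))" for x
      have "exp (w - h0 (v 0)) = 1"
        using h0 v0 w by (simp add: log_branch_def exp_diff)
      then have h: "log_branch \<phi> (drawn_cycle E {0, i, j}) h"
        using log_branch_add[OF h0] by (simp add: h_def[abs_def])
      have hL: "h (v a) = L a" if a: "a = i \<or> a = j" for a
      proof -
        have a1: "a \<in> {1..<n}" using a i j by blast
        have "h (v a) = s a (v a)"
        proof (rule log_branch_unique[where a = "v 0"])
          show "log_branch \<phi> (E {0, a}) h"
            using log_branch_subset[OF h sub[of 0 a]] a a1 by auto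
          show "h (v 0) = s a (v 0)" using s[OF a1] by (simp add: h_def)
        qed (use s[OF a1] edge_connected[OF star[OF a1]] vertex_in_edge[OF star[OF a1]] in auto)
        then show ?thesis using a1 by (simp add: L_def)
      qed
      have "log_branch \<phi> (E e) h"
        using log_branch_subset[OF h sub[of i j]] ij by simp
      then show ?thesis using hL ij(1) by blast
    qed
  qed
  from bchoice[OF this] show ?thesis by blast
qed

end

locale normalised_edge_logs = unseparated_pair +
  fixes L :: "nat \<Rightarrow> complex" and g :: "nat set \<Rightarrow> real^3 \<Rightarrow> complex"
  assumes g: "e \<in> edges n \<Longrightarrow> log_branch \<phi> (E e) (g e)"
    and g_vertex: "e \<in> edges n \<Longrightarrow> i \<in> e \<Longrightarrow> g e (v i) = L i"
begin

text \<open>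
  Simplicity enters here: edges with a common end meet nowhere else.
\<close>

lemma meeting_edges_agree:
  assumes "e \<in> edges n" "f \<in> edges n" "e \<inter> f \<noteq> {}" "x \<in> E e" "x \<in> E f"
  shows "g e x = g f x"
proof (cases "e = f")
  case False
  obtain i where i: "i \<in> e" "i \<in> f" using assms(3) by blast
  then have "x = v i"
    using adjacent_edges_meet_at_vertex[OF assms(1,2) False] assms(4,5) by blast
  then show ?thesis using g_vertex assms(1,2) i by simp
qed simp

lemma cycle_log_extends:
  assumes T: "T \<in> three_cycles n"
  shows "\<exists>h. log_branch \<phi> (drawn_cycle E T) h \<and> (\<forall>e\<in>nsets T 2. \<forall>x\<in>E e. h x = g e x)"
proof -
  have ed: "e \<in> edges n" if "e \<in> nsets T 2" for e
    using three_cycle_edges[OF T] that by blast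
  have fin: "finite (nsets T 2)"
    using T by (auto simp: nsets_def intro: finite_subset[of _ "Pow T"])
  have agree: "g e x = g f x" if "e \<in> nsets T 2" "f \<in> nsets T 2" "x \<in> E e" "x \<in> E f" for e f x
    using that by (intro meeting_edges_agree ed two_subsets_of_triple_meet[OF T])
  show ?thesis unfolding drawn_cycle_def
    using fin edge_closed[OF ed] g[OF ed] agree by (rule log_branch_paste)
qed

text \<open>
  If \<open>k\<close> is not \<open>0\<close>, the lift of \<open>T\<close> and the lift of \<open>T'\<close> translated by \<open>k\<close> are Jordan curves
  that can only meet above points common to two disjoint edges: at a common vertex, and
  along a common edge, the two lifts differ exactly by \<open>k\<close>. So one such crossing forces
  another one, with the same shift \<open>k\<close>.
\<close>

lemma second_shifted_crossing:
  assumes T: "T \<in> three_cycles n" "T' \<in> three_cycles n"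
    and e: "e \<in> nsets T 2" and f: "f \<in> nsets T' 2" and disj: "e \<inter> f = {}"
    and x: "x \<in> E e" "x \<in> E f" and k: "g e x = g f x + k" "k \<noteq> 0"
  shows "\<exists>e'\<in>nsets T 2. \<exists>f'\<in>nsets T' 2. \<exists>y\<in>E e' \<inter> E f'.
           e' \<inter> f' = {} \<and> (e', f') \<noteq> (e, f) \<and> g e' y = g f' y + k"
proof -
  have ed: "\<And>e. e \<in> nsets T 2 \<Longrightarrow> e \<in> edges n" "\<And>f. f \<in> nsets T' 2 \<Longrightarrow> f \<in> edges n"
    using three_cycle_edges T by blast+
  note e' = ed(1)[OF e] and f' = ed(2)[OF f]
  have cyc: "drawn_cycle E T \<subseteq> S2 - {p, q}" "drawn_cycle E T' \<subseteq> S2 - {p, q}"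
    unfolding drawn_cycle_def by (intro UN_least off ed; assumption)+
  have up: "E e \<subseteq> drawn_cycle E T" "E f \<subseteq> drawn_cycle E T'"
    unfolding drawn_cycle_def using e f by (auto intro: UN_upper)
  obtain c1 where c1: "simple_path c1" "pathfinish c1 = pathstart c1" "path_image c1 = drawn_cycle E T"
    using drawn_cycle_loop[OF T(1)] .
  obtain c2 where c2: "simple_path c2" "pathfinish c2 = pathstart c2" "path_image c2 = drawn_cycle E T'"
    using drawn_cycle_loop[OF T(2)] .
  obtain h1 where h1: "log_branch \<phi> (drawn_cycle E T) h1"
      "\<And>e x. e \<in> nsets T 2 \<Longrightarrow> x \<in> E e \<Longrightarrow> h1 x = g e x"
    using cycle_log_extends[OF T(1)] by blast
  obtain h2 where h2: "log_branch \<phi> (drawn_cycle E T') h2"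
      "\<And>f x. f \<in> nsets T' 2 \<Longrightarrow> x \<in> E f \<Longrightarrow> h2 x = g f x"
    using cycle_log_extends[OF T(2)] by blast
  have "\<phi> x = exp (g e x)" "\<phi> x = exp (g f x)"
    by (rule log_branchD[OF g[OF e'] x(1)] log_branchD[OF g[OF f'] x(2)])+
  then have "exp (g f x + k) = exp (g f x)" using k(1) by simp
  then have "exp k = 1" by (simp add: exp_add)
  from log_branch_add[OF h2(1) this]
  have h2k: "log_branch \<phi> (drawn_cycle E T') (\<lambda>x. h2 x + k)" .
  \<comment> \<open>The other two edges of \<open>T\<close> stay away from \<open>x\<close>, so near \<open>x\<close> the cycle is just \<open>e\<close>.\<close>
  define Z where "Z = (\<Union>d\<in>nsets T 2 - {e}. E d)"
  have xZ: "x \<notin> Z"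
  proof
    assume "x \<in> Z"
    then obtain d where d: "d \<in> nsets T 2" "d \<noteq> e" "x \<in> E d" unfolding Z_def by blast
    obtain i where i: "i \<in> e" "i \<in> d"
      using two_subsets_of_triple_meet[OF T(1) e d(1)] by blast
    then have "x = v i"
      using adjacent_edges_meet_at_vertex[OF e' ed(1)[OF d(1)]] d x by blast
    moreover have "i < n" using e' i by (auto simp: nsets_def)
    ultimately have "i \<in> f" using vertex_on_edge_is_end[OF f', of i] x by simp
    then show False using i disj by blast
  qed
  have "finite (nsets T 2)"
    using T(1) by (auto simp: nsets_def intro: finite_subset[of _ "Pow T"])
  then have "closed Z" unfolding Z_def using edge_closed[OF ed(1)] by (intro closed_UN) auto
  then have "openin (top_of_set S2) (S2 \<inter> - Z)" by (intro openin_open_Int) auto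
  moreover have "x \<in> S2 \<inter> - Z" using xZ off[OF e'] x by blast
  moreover have "drawn_cycle E T \<inter> (S2 \<inter> - Z) \<subseteq> E e"
    unfolding Z_def drawn_cycle_def by blast
  moreover have "h1 x = h2 x + k" using h1(2)[OF e x(1)] h2(2)[OF f x(2)] k by simp
  moreover have "x \<in> drawn_cycle E T" "x \<in> drawn_cycle E T'" using up x by blast+
  ultimately obtain y where y: "y \<in> drawn_cycle E T" "y \<in> drawn_cycle E T'" "h1 y = h2 y + k" "y \<noteq> x"
    using lifted_loops_not_single_crossing[OF hom p c1(1,2) _ c2(1,2), of h1 "\<lambda>x. h2 x + k" x "E e" "E f" "S2 \<inter> - Z"]
      c1(3) c2(3) cyc up h1(1) h2k disjoint_edges_cross(1)[OF e' f' disj x] by auto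
  obtain d where d: "d \<in> nsets T 2" "y \<in> E d" using y(1) unfolding drawn_cycle_def by blast
  obtain d' where d': "d' \<in> nsets T' 2" "y \<in> E d'" using y(2) unfolding drawn_cycle_def by blast
  have gk: "g d y = g d' y + k" using y(3) h1(2)[OF d] h2(2)[OF d'] by simp
  then have "d \<inter> d' = {}"
    using meeting_edges_agree[OF ed(1)[OF d(1)] ed(2)[OF d'(1)] _ d(2) d'(2)] k(2) by force
  moreover have "(d, d') \<noteq> (e, f)"
    using disjoint_edges_cross(2)[OF e' f' disj x] d(2) d'(2) y(4) by blast
  ultimately show ?thesis using d d' gk by blast
qed

text \<open>
  Suppose that \<open>{a, b}\<close> and \<open>{c, d}\<close> cross with shift \<open>k \<noteq> 0\<close>. The cycles \<open>{a, b, c}\<close> and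
  \<open>{a, c, d}\<close> have only one further pair of disjoint edges, so \<open>{b, c}\<close> and \<open>{a, d}\<close> cross
  with shift \<open>k\<close> too. The cycles \<open>{b, c, d}\<close> and \<open>{a, b, d}\<close> then force \<open>{c, d}\<close> and
  \<open>{a, b}\<close>, in this order, to cross with shift \<open>k\<close>. But these two edges cross only once, and in
  this order their shift is \<open>- k\<close>.
\<close>

lemma crossing_edges_agree:
  assumes "e \<in> edges n" "f \<in> edges n" "e \<inter> f = {}" "x \<in> E e" "x \<in> E f"
  shows "g e x = g f x"
proof (rule ccontr)
  assume neq: "g e x \<noteq> g f x"
  define k where "k = g e x - g f x"
  have k: "k \<noteq> 0" "g e x = g f x + k" using neq by (simp_all add: k_def)
  obtain a b where ab: "e = {a, b}" "a < n" "b < n" "a \<noteq> b"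
    using assms(1) by (auto simp: edge_nsets_iff)
  obtain c d where cd: "f = {c, d}" "c < n" "d < n" "c \<noteq> d"
    using assms(2) by (auto simp: edge_nsets_iff)
  have ne: "a \<noteq> c" "a \<noteq> d" "b \<noteq> c" "b \<noteq> d" using assms(3) ab cd by auto
  note dist = ab(4) cd(4) ne
  have T: "{a, b, c} \<in> three_cycles n" "{a, c, d} \<in> three_cycles n"
      "{b, c, d} \<in> three_cycles n" "{a, b, d} \<in> three_cycles n"
    using ab cd ne by (simp_all add: nsets_def)
  have N: "nsets {a, b, c} 2 = {{a, b}, {b, c}, {a, c}}" "nsets {a, c, d} 2 = {{a, c}, {c, d}, {a, d}}"
      "nsets {b, c, d} 2 = {{b, c}, {c, d}, {b, d}}" "nsets {a, b, d} 2 = {{a, b}, {b, d}, {a, d}}"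
    using dist by (simp_all add: nsets_triple_2)
  obtain y where y: "y \<in> E {b, c}" "y \<in> E {a, d}" "g {b, c} y = g {a, d} y + k"
  proof -
    obtain e' f' y where *: "e' \<in> nsets {a, b, c} 2" "f' \<in> nsets {a, c, d} 2" "y \<in> E e' \<inter> E f'"
        "e' \<inter> f' = {}" "(e', f') \<noteq> (e, f)" "g e' y = g f' y + k"
      using second_shifted_crossing[OF T(1,2) _ _ assms(3-5) k(2,1)] ab(1) cd(1) dist by auto
    then have "e' = {b, c}" "f' = {a, d}" unfolding N ab(1) cd(1) by auto
    then show ?thesis using * that by blast
  qed
  obtain z where z: "z \<in> E f" "z \<in> E e" "g f z = g e z + k"
  proof -
    have "{b, c} \<inter> {a, d} = {}" using dist by auto
    then obtain e' f' z where *: "e' \<in> nsets {b, c, d} 2" "f' \<in> nsets {a, b, d} 2" "z \<in> E e' \<inter> E f'"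
        "e' \<inter> f' = {}" "(e', f') \<noteq> ({b, c}, {a, d})" "g e' z = g f' z + k"
      using second_shifted_crossing[OF T(3,4) _ _ _ y k(1)] dist by auto
    then have "e' = f" "f' = e" unfolding N ab(1) cd(1) by auto
    then show ?thesis using * that by blast
  qed
  have "z = x" using disjoint_edges_cross(2)[OF assms] z by blast
  then show False using z(3) k by simp
qed

lemma drawn_graph_log: "\<exists>h. log_branch \<phi> (\<Union>e\<in>edges n. E e) h"
proof -
  have "finite (edges n)"
    by (auto simp: nsets_def intro: finite_subset[of _ "Pow (verts n)"])
  then have "\<exists>h. log_branch \<phi> (\<Union>e\<in>edges n. E e) h \<and> (\<forall>e\<in>edges n. \<forall>x\<in>E e. h x = g e x)"
  proof (rule log_branch_paste)
    show "g e x = g f x" if "e \<in> edges n" "f \<in> edges n" "x \<in> E e" "x \<in> E f" for e f x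
      using meeting_edges_agree[OF that(1,2) _ that(3,4)] crossing_edges_agree[OF that(1,2) _ that(3,4)]
      by (cases "e \<inter> f = {}") simp_all
  qed (rule edge_closed g; assumption)+
  then show ?thesis by (elim exE conjE) (rule exI)
qed

end

section \<open>Faces as intersections of sides\<close>

context simple_drawing_Kn
begin

lemma drawn_graph_eq_Union_edges:
  assumes "n \<ge> 2" shows "drawn_graph n v E = (\<Union>e\<in>edges n. E e)"
proof -
  have "v i \<in> (\<Union>e\<in>edges n. E e)" if "i < n" for i
  proof -
    have "{i, if i = 0 then 1 else 0} \<in> edges n" using that assms by auto
    then show ?thesis using vertex_in_edge by blast
  qed
  then show ?thesis unfolding drawn_graph_def by auto
qed

lemma drawn_graph_compact: "compact (drawn_graph n v E)"
proof -
  have "finite (edges n)"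
    by (auto simp: nsets_def intro: finite_subset[of _ "Pow (verts n)"])
  then show ?thesis
    unfolding drawn_graph_def
    by (intro compact_Un compact_UN edge_compact finite_imp_compact[of "v ` verts n"]) simp_all
qed

text \<open>
  The substance of the theorem: 3-cycles alone tell the faces of a simple drawing apart. For distinct
  \<open>p\<close> and \<open>q\<close> the lifts of the edges agree wherever edges meet, so they glue to a branch of
  the logarithm on the whole drawing.
\<close>

lemma unseparated_by_cycles_imp_same_face:
  assumes n3: "n \<ge> 3" and p: "p \<in> S2 - drawn_graph n v E" and q: "q \<in> S2 - drawn_graph n v E"
    and unsep: "\<And>T. T \<in> three_cycles n \<Longrightarrow> connected_component (S2 - drawn_cycle E T) p q"
  shows "connected_component (S2 - drawn_graph n v E) p q"
proof (cases "p = q")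
  case True
  then show ?thesis using p by simp
next
  case False
  have pS: "p \<in> S2" and qS: "q \<in> S2" using p q by auto
  obtain \<phi> \<psi> where hom: "homeomorphism (S2 - {q}) (UNIV :: complex set) \<phi> \<psi>" and \<phi>p: "\<phi> p = 0"
    using stereographic_projection_ex[OF pS qS False] .
  have union: "drawn_graph n v E = (\<Union>e\<in>edges n. E e)"
    using drawn_graph_eq_Union_edges n3 by simp
  have off: "E e \<subseteq> S2 - {p, q}" if "e \<in> edges n" for e
    using edge_in_sphere[OF that] p q that unfolding union by blast
  interpret unseparated_pair n v E p q \<phi> \<psi>
    using n3 hom pS False \<phi>p qS off unsep by unfold_locales
  obtain L g where "\<forall>e\<in>edges n. log_branch \<phi> (E e) (g e) \<and> (\<forall>i\<in>e. g e (v i) = L i)"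
    using normalised_edge_logs_ex by blast
  then interpret normalised_edge_logs n v E p q \<phi> \<psi> L g
    by unfold_locales simp_all
  have "drawn_graph n v E \<subseteq> S2 - {p, q}"
    unfolding union using off by blast
  then show ?thesis
    using connected_component_sphere_iff_log_branch[OF hom qS drawn_graph_compact _ pS False \<phi>p]
      drawn_graph_log unfolding union by simp
qed

end

theorem theorem2:
  fixes n :: nat and v :: "nat \<Rightarrow> real^3" and E :: "nat set \<Rightarrow> (real^3) set"
    and R :: "(real^3) set"
  assumes "n \<ge> 3"
    and "simple_drawing n v E"
    and "R \<in> faces n v E"
  shows "R = (\<Inter>T\<in>three_cycles n. side_containing E T R)"
proof -
  interpret simple_drawing_Kn n v E
    using assms(2) by unfold_locales
  have side: "side_containing E T R \<in> sides E T" "R \<subseteq> side_containing E T R"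
    if "T \<in> three_cycles n" for T
    using theI'[OF side_containing_ex1[OF assms(3) that]] unfolding side_containing_def by blast+
  have union: "drawn_graph n v E = (\<Union>e\<in>edges n. E e)"
    using drawn_graph_eq_Union_edges assms(1) by simp
  obtain p where p: "p \<in> S2 - drawn_graph n v E" and R: "R = connected_component_set (S2 - drawn_graph n v E) p"
    using assms(3) unfolding faces_def components_def by blast
  have pR: "p \<in> R" using p R by simp
  show ?thesis
  proof (intro equalityI INT_greatest side(2))
    show "(\<Inter>T\<in>three_cycles n. side_containing E T R) \<subseteq> R"
    proof
      fix q assume "q \<in> (\<Inter>T\<in>three_cycles n. side_containing E T R)"
      then have q: "q \<in> side_containing E T R" if "T \<in> three_cycles n" for T
        using that by blast
      have off: "q \<in> S2 - drawn_cycle E T" if "T \<in> three_cycles n" for T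
        using q[OF that] side(1)[OF that] in_components_subset unfolding sides_def by blast
      \<comment> \<open>As \<open>n \<ge> 3\<close>, every edge lies on some 3-cycle, so a point of all sides is off the drawing.\<close>
      have "q \<notin> E e" if e: "e \<in> edges n" for e
      proof -
        obtain i j where ij: "e = {i, j}" "i < n" "j < n" "i \<noteq> j"
          using e by (auto simp: edge_nsets_iff)
        have "\<not> {..<n} \<subseteq> {i, j}"
          using card_mono[of "{i, j}" "{..<n}"] assms(1) ij(4) by auto
        then obtain l where "l < n" "l \<noteq> i" "l \<noteq> j" by auto
        then have T: "{i, j, l} \<in> three_cycles n" using ij by (simp add: nsets_def)
        have "e \<in> nsets {i, j, l} 2" using ij by simp
        then show ?thesis using off[OF T] unfolding drawn_cycle_def by blast
      qed
      moreover have "q \<in> S2"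
      proof -
        have "{0, 1, 2} \<in> three_cycles n" using assms(1) by (simp add: nsets_def)
        then show ?thesis using off by blast
      qed
      ultimately have qD: "q \<in> S2 - drawn_graph n v E" unfolding union by blast
      have "connected_component (S2 - drawn_cycle E T) p q" if T: "T \<in> three_cycles n" for T
      proof -
        have "connected (side_containing E T R)" "side_containing E T R \<subseteq> S2 - drawn_cycle E T"
          using side(1)[OF T] in_components_connected in_components_subset unfolding sides_def by blast+
        then show ?thesis
          unfolding connected_component_def using q[OF T] side(2)[OF T] pR by blast
      qed
      then have "connected_component (S2 - drawn_graph n v E) p q"
        using unseparated_by_cycles_imp_same_face[OF assms(1) p qD] by blast
      then show "q \<in> R" unfolding R by simp
    qed
  qed
qed

end
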